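(* The branching graph $\Gamma_H$ (of the tower $A_{(\mathcal{H},\delta)}(0)\subset A_{(\mathcal{H},\delta)}(1)\subset\cdots$ at generic loop parameter) can be identified with the pascalization $\mathcal{P}(\Theta)$ of the coupled Young graph $\Theta$ through the map $(\lambda,\mu)\in\Gamma_{H,n}\mapsto(n,(\lambda,\mu))\in\mathcal{P}(\Theta)_n$; i.e. this map is an isomorphism of graded graphs.
   Context: $\mathbb{Y}_k$ is the set of Young diagrams with $k$ boxes, $|\lambda|$ the number of boxes of $\lambda$, and $\lambda\pm\Box$ denotes a diagram obtained by adding/removing one box. The branching graph $\Gamma_H$ (computed by Orellana) is the graded graph whose level-$n$ vertex set $\Gamma_{H,n}$ consists of the pairs $(\lambda,\mu)$ of Young diagrams with $2|\lambda|+|\mu|\le n$ and $2|\lambda|+|\mu|\equiv n\bmod2$, with one edge between $(\lambda,\mu)\in\Gamma_{H,n}$ and $(\xi,\eta)\in\Gamma_{H,n+1}$ iff $(\xi,\eta)$ is of one of the forms $(\lambda,\mu+\Box)$, $(\lambda,\mu-\Box)$, $(\lambda+\Box,\mu-\Box)$, $(\lambda-\Box,\mu+\Box)$. Here $A_{(\mathcal{H},\delta)}(k)$ is the diagram algebra with basis the set partitions of $k$ upper and $k$ lower points with all blocks of even size. The coupled Young graph $\Theta$ is the graded graph with $\Theta_n=\bigsqcup_{k=0}^{\lfloor n/2\rfloor}\mathbb{Y}_k\times\mathbb{Y}_{n-2k}$ and one edge between $(\lambda,\mu)\in\Theta_n$ and $(\lambda',\mu')\in\Theta_{n+1}$ iff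 either $\lambda'=\lambda$, $\mu'=\mu+\Box$, or $\lambda'=\lambda+\Box$, $\mu'=\mu-\Box$. The pascalization $\mathcal{P}(\Gamma)$ of a graded graph $\Gamma$ has level-$n$ vertex set $\mathcal{P}(\Gamma)_n=\{(n,\gamma):\gamma\in\Gamma_k,\ k\le n,\ k\equiv n\bmod2\}$; the number of edges between $(n,\gamma)$ and $(n+1,\tilde\gamma)$ is the number of undirected edges between $\gamma$ and $\tilde\gamma$ in $\Gamma$. *)

theory Defs
  imports Main
begin

typedef young_diagram =
  "{D :: (nat \<times> nat) set. finite D \<and> (\<forall>i j i' j'. (i, j) \<in> D \<and> i' \<le> i \<and> j' \<le> j \<longrightarrow> (i', j') \<in> D)}"
  morphisms boxes Young
  by (rule exI[of _ "{}"]) simp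

definition num_boxes :: "young_diagram \<Rightarrow> nat" where
  "num_boxes \<alpha> = card (boxes \<alpha>)"

definition Young_diagrams :: "nat \<Rightarrow> young_diagram set" where
  "Young_diagrams k = {\<alpha>. num_boxes \<alpha> = k}"

(* adds_box \<alpha> \<mu> says that \<mu> is of the form \<alpha> + Box, equivalently that \<alpha> is of the form \<mu> - Box. *)
definition adds_box :: "young_diagram \<Rightarrow> young_diagram \<Rightarrow> bool" where
  "adds_box \<alpha> \<mu> \<longleftrightarrow> (\<exists>b. b \<notin> boxes \<alpha> \<and> boxes \<mu> = insert b (boxes \<alpha>))"

(* The vertex set of a graded graph is the disjoint union of its levels: the same element of 'v may
   lie in several levels, and then stands for a different vertex in each of them.
   edges G n v w is the number of edges between v in level n and w in level n + 1; its values at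
   other arguments are irrelevant. *)
record 'v graded_graph =
  level :: "nat \<Rightarrow> 'v set"
  edges :: "nat \<Rightarrow> 'v \<Rightarrow> 'v \<Rightarrow> nat"

definition graded_graph_iso ::
  "'v graded_graph \<Rightarrow> 'w graded_graph \<Rightarrow> (nat \<Rightarrow> 'v \<Rightarrow> 'w) \<Rightarrow> bool" where
  "graded_graph_iso G H \<phi> \<longleftrightarrow>
     (\<forall>n. bij_betw (\<phi> n) (level G n) (level H n)) \<and>
     (\<forall>n. \<forall>v \<in> level G n. \<forall>w \<in> level G (n + 1).
        edges H n (\<phi> n v) (\<phi> (n + 1) w) = edges G n v w)"

(* For graphs whose levels are pairwise disjoint, so that an element of 'v determines its level and
   each of the two sums has at most one term. *)
definition undirected_edges :: "'v graded_graph \<Rightarrow> 'v \<Rightarrow> 'v \<Rightarrow> nat" where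
  "undirected_edges G v w =
     (\<Sum>k | v \<in> level G k \<and> w \<in> level G (k + 1). edges G k v w) +
     (\<Sum>k | w \<in> level G k \<and> v \<in> level G (k + 1). edges G k w v)"

definition pascalization :: "'v graded_graph \<Rightarrow> (nat \<times> 'v) graded_graph" where
  "pascalization G =
     \<lparr>level = (\<lambda>n. {(n, \<gamma>) | \<gamma> k. \<gamma> \<in> level G k \<and> k \<le> n \<and> k mod 2 = n mod 2}),
      edges = (\<lambda>n (_, \<gamma>) (_, \<gamma>'). undirected_edges G \<gamma> \<gamma>')\<rparr>"

definition coupled_Young_graph :: "(young_diagram \<times> young_diagram) graded_graph" where
  "coupled_Young_graph =
     \<lparr>level = (\<lambda>n. \<Union>k \<in> {0..n div 2}. Young_diagrams k \<times> Young_diagrams (n - 2 * k)),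
      edges = (\<lambda>n (\<alpha>, \<mu>) (\<alpha>', \<mu>').
        if (\<alpha>' = \<alpha> \<and> adds_box \<mu> \<mu>') \<or> (adds_box \<alpha> \<alpha>' \<and> adds_box \<mu>' \<mu>) then 1 else 0)\<rparr>"

lemma coupled_Young_graph_levels_disjoint:
  assumes "m \<noteq> n"
  shows "level coupled_Young_graph m \<inter> level coupled_Young_graph n = {}"
  using assms by (auto simp: coupled_Young_graph_def Young_diagrams_def)

(* Orellana's explicit description of the branching graph of the tower of diagram algebras spanned
   by the set partitions of k upper and k lower points with all blocks of even size, at generic
   loop parameter. *)
definition branching_graph_H :: "(young_diagram \<times> young_diagram) graded_graph" where
  "branching_graph_H =
     \<lparr>level = (\<lambda>n. {(\<alpha>, \<mu>). 2 * num_boxes \<alpha> + num_boxes \<mu> \<le> n \<and>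
                            (2 * num_boxes \<alpha> + num_boxes \<mu>) mod 2 = n mod 2}),
      edges = (\<lambda>n (\<alpha>, \<mu>) (\<xi>, \<eta>).
        if (\<xi> = \<alpha> \<and> adds_box \<mu> \<eta>) \<or> (\<xi> = \<alpha> \<and> adds_box \<eta> \<mu>) \<or>
           (adds_box \<alpha> \<xi> \<and> adds_box \<eta> \<mu>) \<or> (adds_box \<xi> \<alpha> \<and> adds_box \<mu> \<eta>)
        then 1 else 0)\<rparr>"

end

theory Submission
  imports Defs
begin

text \<open>
  A pair \<open>(\<alpha>, \<mu>)\<close> lies in exactly one level of the coupled Young graph, namely the one whose
  number is its weight \<open>2 * num_boxes \<alpha> + num_boxes \<mu>\<close>. Hence the condition
  that defines the levels of the branching graph is the one that pascalization imposes: the weight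
  is at most \<open>n\<close> and has the parity of \<open>n\<close>.

  For the edges, a directed step of the coupled Young graph adds a box to the second diagram, or
  moves a box from the second diagram to the first one; both raise the weight by exactly one. So
  a directed step automatically joins consecutive levels, and two pairs cannot be joined by directed
  steps in both directions. Thus there is at most one undirected edge between two pairs, and there
  is one iff a directed step leads one way or the other. Adding the reversed steps to the two
  directed ones gives precisely the four moves of the branching graph.
\<close>

definition coupled_weight :: "young_diagram \<times> young_diagram \<Rightarrow> nat" where
  "coupled_weight = (\<lambda>(\<alpha>, \<mu>). 2 * num_boxes \<alpha> + num_boxes \<mu>)"

definition coupled_step :: "young_diagram \<times> young_diagram \<Rightarrow> young_diagram \<times> young_diagram \<Rightarrow> bool" where
  "coupled_step = (\<lambda>(\<alpha>, \<mu>) (\<alpha>', \<mu>').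
     (\<alpha>' = \<alpha> \<and> adds_box \<mu> \<mu>') \<or> (adds_box \<alpha> \<alpha>' \<and> adds_box \<mu>' \<mu>))"

lemma finite_boxes: "finite (boxes \<alpha>)"
  using boxes [of \<alpha>] by simp

lemma num_boxes_adds_box:
  assumes "adds_box \<alpha> \<mu>"
  shows "num_boxes \<mu> = Suc (num_boxes \<alpha>)"
  using assms by (auto simp: adds_box_def num_boxes_def finite_boxes)

text \<open>Moving a box from the second diagram to the first gains two and loses one, so it
  changes the weight by as much as adding a box to the second diagram.\<close>

lemma coupled_weight_step:
  assumes "coupled_step v w"
  shows "coupled_weight w = Suc (coupled_weight v)"
  using assms
  by (auto simp: coupled_step_def coupled_weight_def split: prod.splits
      dest!: num_boxes_adds_box)

lemma in_level_coupled_Young_graph: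
  "v \<in> level coupled_Young_graph n \<longleftrightarrow> coupled_weight v = n"
  by (cases v) (auto simp: coupled_Young_graph_def Young_diagrams_def coupled_weight_def)

lemma edges_coupled_Young_graph:
  "edges coupled_Young_graph n v w = of_bool (coupled_step v w)"
  by (cases v; cases w) (simp add: coupled_Young_graph_def coupled_step_def)

text \<open>Either of the two sums in the number of undirected edges runs over at most one level, and
  that level imposes no condition beyond the existence of a step, because a step raises the weight
  by one. For the same reason the two sums are not both nonzero.\<close>

lemma undirected_edges_coupled_Young_graph:
  "undirected_edges coupled_Young_graph v w = of_bool (coupled_step v w \<or> coupled_step w v)"
proof -
  have directed: "(\<Sum>k | a \<in> level coupled_Young_graph k \<and> b \<in> level coupled_Young_graph (k + 1).
      edges coupled_Young_graph k a b) = of_bool (coupled_step a b)" for a b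
  proof -
    have levels: "{k. a \<in> level coupled_Young_graph k \<and> b \<in> level coupled_Young_graph (k + 1)} =
        (if coupled_weight b = Suc (coupled_weight a) then {coupled_weight a} else {})"
      by (auto simp: in_level_coupled_Young_graph)
    show ?thesis
      unfolding levels edges_coupled_Young_graph
      using coupled_weight_step [of a b] by auto
  qed
  have "\<not> (coupled_step v w \<and> coupled_step w v)"
    using coupled_weight_step [of v w] coupled_weight_step [of w v] by auto
  then show ?thesis
    unfolding undirected_edges_def directed by auto
qed

lemma level_pascalization_coupled_Young_graph:
  "level (pascalization coupled_Young_graph) n = Pair n ` level branching_graph_H n"
  by (auto simp: pascalization_def branching_graph_H_def in_level_coupled_Young_graph
      coupled_weight_def)

lemma edges_branching_graph_H:
  "edges branching_graph_H n v w = of_bool (coupled_step v w \<or> coupled_step w v)"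
  by (cases v; cases w) (auto simp: branching_graph_H_def coupled_step_def)

theorem proposition5p2:
  "graded_graph_iso branching_graph_H (pascalization coupled_Young_graph)
     (\<lambda>n (\<alpha>, \<mu>). (n, (\<alpha>, \<mu>)))"
proof -
  have map_eq: "(\<lambda>n (\<alpha>, \<mu>). (n, (\<alpha>, \<mu>))) =
      (Pair :: nat \<Rightarrow> young_diagram \<times> young_diagram \<Rightarrow> nat \<times> young_diagram \<times> young_diagram)"
    by (simp add: fun_eq_iff)
  have "bij_betw (Pair n) (level branching_graph_H n)
      (level (pascalization coupled_Young_graph) n)" for n
    by (simp add: bij_betw_def inj_on_def level_pascalization_coupled_Young_graph)
  moreover have "edges (pascalization coupled_Young_graph) n (n, v) (n + 1, w) =
      edges branching_graph_H n v w" for n v w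
    by (simp add: pascalization_def undirected_edges_coupled_Young_graph edges_branching_graph_H)
  ultimately show ?thesis
    unfolding graded_graph_iso_def map_eq by blast
qed

end
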